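(* Let $\mathcal D$ be a distinguisher in the following game. Phase 1: A uniform permutation $P:\{0,1\}^n\to\{0,1\}^n$ is chosen, and $\mathcal D$ is given quantum access to $P_0=P$ and $P_0^{-1}=P^{-1}$. Phase 2: Uniform $s_0,s_1\in\{0,1\}^n$ are chosen (independently), and we let $P_1=P\circ\mathrm{swap}_{s_0,s_1}$. A uniform bit $b\in\{0,1\}$ is chosen, and $\mathcal D$ is given $s_0,s_1$ and quantum access to $P_b,P_b^{-1}$. Then $\mathcal D$ outputs a guess $b'$. For any $\mathcal D$ making at most $q$ queries (combined) to $P_0,P_0^{-1}$ in the first phase (with no bound on the number of queries in the second phase), $$\left|\Pr[\mathcal D\text{ outputs }1\mid b=1]-\Pr[\mathcal D\text{ outputs }1\mid b=0]\right|\le 4\sqrt{q/2^n}.$$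
   Context: For $a,b\in\{0,1\}^n$, $\mathrm{swap}_{a,b}:\{0,1\}^n\to\{0,1\}^n$ is the permutation that maps $a\mapsto b$ and $b\mapsto a$ and is otherwise the identity (it is the identity if $a=b$). Quantum access to $f:\{0,1\}^n\to\{0,1\}^n$ means access to the unitary $|x\rangle|y\rangle\mapsto|x\rangle|y\oplus f(x)\rangle$. $\mathcal D$ is a (computationally unbounded) quantum algorithm that keeps its internal state between the phases. *)

theory Defs
  imports "HOL-Probability.Probability"
begin

type_synonym 'n bits = "bool ^ 'n"

definition xor_bits :: "'n::finite bits \<Rightarrow> 'n bits \<Rightarrow> 'n bits" (infixl "\<oplus>" 65) where
  "x \<oplus> y = (\<chi> i. x $ i \<noteq> y $ i)"

text \<open>Qualified because \<open>transpose\<close> alone is matrix transposition here.\<close>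
abbreviation swap :: "'n::finite bits \<Rightarrow> 'n bits \<Rightarrow> 'n bits \<Rightarrow> 'n bits" where
  "swap \<equiv> Transposition.transpose"

text \<open>Computational basis states \<open>|w\<rangle>|x\<rangle>|y\<rangle>\<close> of the distinguisher's whole memory: a
  workspace of arbitrary finite dimension and the two query registers.\<close>
type_synonym ('w, 'n) basis = "'w \<times> 'n bits \<times> 'n bits"
type_synonym ('w, 'n) qstate = "complex ^ ('w, 'n) basis"
type_synonym ('w, 'n) qmat = "complex ^ ('w, 'n) basis ^ ('w, 'n) basis"

definition adjoint_mat :: "complex ^ 'd ^ 'd \<Rightarrow> complex ^ 'd ^ 'd" where
  "adjoint_mat U = (\<chi> i j. cnj (U $ j $ i))"

definition unitary_mat :: "complex ^ 'd ^ 'd \<Rightarrow> bool" where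
  "unitary_mat U \<longleftrightarrow> adjoint_mat U ** U = mat 1 \<and> U ** adjoint_mat U = mat 1"

definition query_mat :: "('n::finite bits \<Rightarrow> 'n bits) \<Rightarrow> ('w::finite, 'n) qmat" where
  "query_mat f = (\<chi> i j. case j of (w, x, y) \<Rightarrow> if i = (w, x, y \<oplus> f x) then 1 else 0)"

lemma query_mat_basis_state:
  fixes f :: "'b::finite bits \<Rightarrow> 'b bits" and w :: "'a::finite"
  shows "query_mat f *v axis (w, x, y) 1 = axis (w, x, y \<oplus> f x) 1"
proof -
  have "a * axis k 1 $ j = (if j = k then a else 0)" for a :: complex and j k :: "('a, 'b) basis"
    by (simp add: axis_def)
  then have "(query_mat f *v axis k 1) $ i = query_mat f $ i $ k" for i k :: "('a, 'b) basis"
    by (simp only: matrix_vector_mult_def vec_lambda_beta sum.delta finite_UNIV UNIV_I if_True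
        sum.delta' finite)
  then show ?thesis
    by (auto simp: vec_eq_iff[where 'b = "('a, 'b) basis"] query_mat_def axis_def)
qed

text \<open>The projector onto the span of the basis states in \<open>A\<close>.\<close>
definition proj_onto :: "'d set \<Rightarrow> complex ^ 'd \<Rightarrow> complex ^ 'd" where
  "proj_onto A \<psi> = (\<chi> i. if i \<in> A then \<psi> $ i else 0)"

text \<open>
  A quantum algorithm with quantum access to a permutation and its inverse: unitaries on the
  whole memory, single queries to either, and measurements whose outcome may decide how the
  computation continues. \<open>Measure A c d\<close> is the two-outcome measurement given by the projectors
  onto the basis states in \<open>A\<close> and outside \<open>A\<close>; it continues with \<open>c\<close> or with \<open>d\<close>,
  respectively. \<open>Return r\<close> stops with classical result \<open>r\<close>.
\<close>
datatype ('r, 'w, 'n) qalg =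
    Return 'r
  | Unitary "('w, 'n) qmat" "('r, 'w, 'n) qalg"
  | Query "('r, 'w, 'n) qalg"
  | Query_Inv "('r, 'w, 'n) qalg"
  | Measure "('w, 'n) basis set" "('r, 'w, 'n) qalg" "('r, 'w, 'n) qalg"

primrec wf_qalg :: "('r, 'w::finite, 'n::finite) qalg \<Rightarrow> bool" where
  "wf_qalg (Return r) \<longleftrightarrow> True"
| "wf_qalg (Unitary U c) \<longleftrightarrow> unitary_mat U \<and> wf_qalg c"
| "wf_qalg (Query c) \<longleftrightarrow> wf_qalg c"
| "wf_qalg (Query_Inv c) \<longleftrightarrow> wf_qalg c"
| "wf_qalg (Measure A c d) \<longleftrightarrow> wf_qalg c \<and> wf_qalg d"

text \<open>The number of queries in either direction, in the worst case over measurement outcomes.\<close>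
primrec num_queries :: "('r, 'w::finite, 'n::finite) qalg \<Rightarrow> nat" where
  "num_queries (Return r) = 0"
| "num_queries (Unitary U c) = num_queries c"
| "num_queries (Query c) = Suc (num_queries c)"
| "num_queries (Query_Inv c) = Suc (num_queries c)"
| "num_queries (Measure A c d) = max (num_queries c) (num_queries d)"

text \<open>
  The joint distribution of the classical result and the final state when the algorithm is
  started in a unit vector. Measurements follow the Born rule, and \<open>sgn\<close> normalises the
  collapsed state.
\<close>
primrec run :: "('n::finite bits \<Rightarrow> 'n bits) \<Rightarrow> ('r, 'w::finite, 'n) qalg \<Rightarrow>
    ('w, 'n) qstate \<Rightarrow> ('r \<times> ('w, 'n) qstate) pmf" where
  "run P (Return r) \<psi> = return_pmf (r, \<psi>)"
| "run P (Unitary U c) \<psi> = run P c (U *v \<psi>)"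
| "run P (Query c) \<psi> = run P c (query_mat P *v \<psi>)"
| "run P (Query_Inv c) \<psi> = run P c (query_mat (inv P) *v \<psi>)"
| "run P (Measure A c d) \<psi> = do {
     in_A \<leftarrow> bernoulli_pmf ((norm (proj_onto A \<psi>))\<^sup>2);
     if in_A then run P c (sgn (proj_onto A \<psi>)) else run P d (sgn (proj_onto (- A) \<psi>))
   }"

text \<open>Between the phases the distinguisher keeps the quantum state and the classical result of
  phase 1, of type \<open>'m\<close>.\<close>
record ('m, 'w, 'n) distinguisher =
  init_state :: "('w, 'n) qstate"
  phase1 :: "('m, 'w, 'n) qalg"
  phase2 :: "'m \<Rightarrow> 'n bits \<Rightarrow> 'n bits \<Rightarrow> (bool, 'w, 'n) qalg"

definition wf_distinguisher :: "('m, 'w::finite, 'n::finite) distinguisher \<Rightarrow> bool" where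
  "wf_distinguisher D \<longleftrightarrow> norm (init_state D) = 1 \<and> wf_qalg (phase1 D) \<and>
     (\<forall>m s0 s1. wf_qalg (phase2 D m s0 s1))"

text \<open>The joint distribution of the challenge bit \<open>b\<close> and the guess \<open>b'\<close>.\<close>
definition game :: "('m, 'w::finite, 'n::finite) distinguisher \<Rightarrow> (bool \<times> bool) pmf" where
  "game D = do {
     P \<leftarrow> pmf_of_set {P :: 'n bits \<Rightarrow> 'n bits. bij P};
     (m, \<psi>) \<leftarrow> run P (phase1 D) (init_state D);
     s0 \<leftarrow> pmf_of_set UNIV;
     s1 \<leftarrow> pmf_of_set UNIV;
     b \<leftarrow> pmf_of_set UNIV;
     (b', _) \<leftarrow> run (if b then P \<circ> swap s0 s1 else P) (phase2 D m s0 s1) \<psi>;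
     return_pmf (b, b')
   }"

end

(*
  Since P o swap is again a uniform permutation, the two games differ only in whether phase 1 was
  run with P or with P o swap, while phase 2 sees P. As a function of P, the (unnormalised) state
  after q queries lies in the span of the indicators of {P. P x1 = y1 & ... & P xk = yk} with
  k <= q. On this space the self-adjoint operator
  g |-> (sum over s, t of g - g o swap s t) is small: a transposition moves such an indicator only
  if s or t is one of the x's, so the operator has norm at most 4 q N with respect to the norm
  "least total coefficient of a representation by indicators", where N = 2^n. Eigenvalues are
  bounded by any operator norm, hence the same bound holds for the quadratic form in l2. This makes
  the mean squared distance between the states for P and for P o swap at most 8 q / N, and
  Cauchy-Schwarz gives the advantage sqrt (8 q / N).
*)

theory Submission
  imports Defs
begin

section \<open>Functions of low degree on permutations\<close>

text \<open>Coefficients are vectors, so that a state depending on \<open>P\<close> is itself a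
  single polynomial.\<close>

definition monomial :: "('a \<times> 'b) set \<Rightarrow> 'v::zero \<Rightarrow> ('a \<Rightarrow> 'b) \<Rightarrow> 'v" where
  "monomial S v P = (if \<forall>(x, y)\<in>S. P x = y then v else 0)"

text \<open>\<open>poly_bound q C f\<close>: \<open>f\<close> is a sum of monomials of degree at most \<open>q\<close> whose coefficients have
  total norm at most \<open>C\<close>.\<close>
inductive poly_bound :: "nat \<Rightarrow> real \<Rightarrow> (('a \<Rightarrow> 'b) \<Rightarrow> 'v::real_normed_vector) \<Rightarrow> bool"
  for q :: nat where
  monomial: "finite S \<Longrightarrow> card S \<le> q \<Longrightarrow> norm v \<le> C \<Longrightarrow> poly_bound q C (monomial S v)"
| add: "poly_bound q C f \<Longrightarrow> poly_bound q C' g \<Longrightarrow> poly_bound q (C + C') (\<lambda>P. f P + g P)"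

lemma poly_bound_zero: "poly_bound q 0 (\<lambda>P. 0)"
  using poly_bound.monomial[of "{}" q 0 0] by (simp add: monomial_def[abs_def])

lemma poly_bound_const: "poly_bound q (norm v) (\<lambda>P. v)"
  using poly_bound.monomial[of "{}" q v "norm v"] by (simp add: monomial_def[abs_def])

lemma poly_bound_sum:
  assumes "\<And>i. i \<in> I \<Longrightarrow> poly_bound q (C i) (f i)"
  shows "poly_bound q (sum C I) (\<lambda>P. \<Sum>i\<in>I. f i P)"
  using assms
  by (induction I rule: infinite_finite_induct) (auto intro: poly_bound_zero poly_bound.add)

text \<open>Only the degree has to survive: the bound of \<open>perm_inner_swap_lap_le\<close> is
  free of \<open>C\<close>, so the existence of some constant suffices.\<close>

lemma poly_bound_linear:
  assumes "poly_bound q C f" "bounded_linear T"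
  shows "\<exists>C. poly_bound q C (\<lambda>P. T (f P))"
  using assms(1)
proof induction
  case (monomial S v C)
  have "(\<lambda>P. T (monomial S v P)) = monomial S (T v)"
    using assms(2) by (auto simp: monomial_def linear_simps)
  with monomial show ?case
    using poly_bound.monomial[of S q "T v" "norm (T v)"] by auto
next
  case (add C f C' g)
  then show ?case
    using assms(2) by (auto simp: linear_simps dest: poly_bound.add)
qed

text \<open>A product of indicators is the indicator of the joint conditions, so a further condition
  \<open>P x = y\<close> costs one degree and leaves the coefficients alone.\<close>

lemma poly_bound_mult:
  assumes "poly_bound q C f"
  shows "poly_bound (Suc q) C (\<lambda>P. monomial {(x, y)} (f P) P)"
  using assms
proof induction
  case (monomial S v C)
  have "(\<lambda>P. monomial {(x, y)} (monomial S v P) P) = monomial (insert (x, y) S) v"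
    by (auto simp: monomial_def)
  with monomial show ?case
    by (auto intro!: poly_bound.monomial order.trans[OF card_insert_le_m1])
next
  case (add C f C' g)
  have "(\<lambda>P. monomial {(x, y)} (f P + g P) P)
      = (\<lambda>P. monomial {(x, y)} (f P) P + monomial {(x, y)} (g P) P)"
    by (auto simp: monomial_def)
  with add show ?case
    by (auto intro: poly_bound.add)
qed

lemma norm_le_poly_bound: "poly_bound q C f \<Longrightarrow> norm (f P) \<le> C"
proof (induction rule: poly_bound.induct)
  case (monomial S v C)
  then show ?case
    using norm_ge_zero[of v] by (auto simp: monomial_def simp del: norm_ge_zero)
next
  case (add C f C' g)
  then show ?case
    using norm_triangle_mono by blast
qed

text \<open>The constant \<open>swap\<close> is restricted to bit strings.\<close>
abbreviation transposition :: "'a \<Rightarrow> 'a \<Rightarrow> 'a \<Rightarrow> 'a" where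
  "transposition \<equiv> Transposition.transpose"

section \<open>The transposition Laplacian on polynomials\<close>

text \<open>On permutations this is twice the Laplacian of the Cayley graph generated by
  transpositions: pairs are ordered, so each transposition counts twice, and pairs with
  \<open>s = t\<close> contribute 0.\<close>

definition swap_lap :: "(('a::finite \<Rightarrow> 'a) \<Rightarrow> 'v::real_normed_vector) \<Rightarrow> ('a \<Rightarrow> 'a) \<Rightarrow> 'v" where
  "swap_lap f P = (\<Sum>s\<in>UNIV. \<Sum>t\<in>UNIV. f P - f (P \<circ> transposition s t))"

lemma monomial_transpose:
  fixes P :: "'a::finite \<Rightarrow> 'a"
  shows "monomial S v (P \<circ> transposition s t)
    = monomial (map_prod (transposition s t) id ` S) v P"
  by (auto simp: monomial_def)

text \<open>A transposition that avoids the first coordinates of \<open>S\<close> fixes the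
  monomial. With N the size of \<open>'a\<close>, at most \<open>2 * q * N\<close> ordered pairs
  remain, and each yields two monomials of coefficient norm at most \<open>C\<close>.\<close>

lemma swap_lap_monomial:
  fixes S :: "('a::finite \<times> 'a) set"
  assumes "card S \<le> q" "norm v \<le> C"
  shows "\<exists>C'\<le>4 * real q * real CARD('a) * C. poly_bound q C' (swap_lap (monomial S v))"
proof -
  let ?X = "fst ` S"
  define d where "d s t = (if s \<in> ?X \<or> t \<in> ?X then 2 * C else 0)" for s t
  have C: "0 \<le> C"
    using assms(2) norm_ge_zero order.trans by blast
  have fin: "finite S"
    by simp
  have cX: "card ?X \<le> q"
    using card_image_le[OF fin, of fst] assms(1) by linarith
  have "poly_bound q (d s t) (\<lambda>P. monomial S v P - monomial S v (P \<circ> transposition s t))" for s t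
  proof (cases "s \<in> ?X \<or> t \<in> ?X")
    case True
    let ?S' = "map_prod (transposition s t) id ` S"
    have "card ?S' \<le> q"
      using card_image_le[OF fin, of "map_prod (transposition s t) id"] assms(1) by linarith
    then have "poly_bound q (C + C) (\<lambda>P. monomial S v P + monomial ?S' (- v) P)"
      using assms by (intro poly_bound.intros) auto
    moreover have "monomial S v P + monomial ?S' (- v) P
        = monomial S v P - monomial S v (P \<circ> transposition s t)" for P
      by (auto simp: monomial_transpose) (auto simp: monomial_def)
    ultimately show ?thesis
      using True by (simp add: d_def)
  next
    case False
    then have "transposition s t x = x" if "(x, y) \<in> S" for x y
      using that by (metis Transposition.transpose_apply_other fst_conv image_eqI)
    then have "monomial S v (P \<circ> transposition s t) = monomial S v P" for P
      by (auto simp: monomial_def)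
    with False show ?thesis
      by (auto simp: d_def poly_bound_zero)
  qed
  then have *: "poly_bound q (\<Sum>s\<in>UNIV. \<Sum>t\<in>UNIV. d s t) (swap_lap (monomial S v))"
    unfolding swap_lap_def[abs_def] by (intro poly_bound_sum)
  \<comment> \<open>Union bound: each of \<open>s \<in> ?X\<close> and \<open>t \<in> ?X\<close>
    holds for \<open>card ?X * CARD('a)\<close> pairs.\<close>
  have "(\<Sum>s\<in>UNIV. \<Sum>t\<in>UNIV. d s t)
      \<le> (\<Sum>s\<in>UNIV. \<Sum>t\<in>UNIV. of_bool (s \<in> ?X) * (2 * C) + of_bool (t \<in> ?X) * (2 * C))"
    using C by (intro sum_mono) (auto simp: d_def)
  also have "\<dots> = 4 * real (card ?X) * real CARD('a) * C"
    by (simp add: sum.distrib algebra_simps flip: sum_distrib_left sum_distrib_right)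
  also have "\<dots> \<le> 4 * real q * real CARD('a) * C"
    using cX C by (intro mult_right_mono mult_left_mono) auto
  finally show ?thesis
    using * by blast
qed

lemma swap_lap_add: "swap_lap (\<lambda>P. f P + g P) = (\<lambda>P. swap_lap f P + swap_lap g P)"
  by (auto simp: swap_lap_def add_diff_add sum.distrib)

lemma poly_bound_swap_lap:
  fixes f :: "('a::finite \<Rightarrow> 'a) \<Rightarrow> 'v::real_normed_vector"
  assumes "poly_bound q C f"
  shows "\<exists>C'\<le>4 * real q * real CARD('a) * C. poly_bound q C' (swap_lap f)"
  using assms
proof induction
  case (monomial S v C)
  then show ?case
    by (intro swap_lap_monomial)
next
  case (add C f C' g)
  then obtain D D' where "D \<le> 4 * real q * real CARD('a) * C" "poly_bound q D (swap_lap f)"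
    "D' \<le> 4 * real q * real CARD('a) * C'" "poly_bound q D' (swap_lap g)"
    by blast
  then show ?case
    by (intro exI[of _ "D + D'"]) (auto simp: swap_lap_add distrib_left intro: poly_bound.add)
qed

section \<open>The inner product over permutations and the spectral bound\<close>

text \<open>Only bijections are summed while \<open>f\<close> and \<open>g\<close> live on all maps,
  so the form is positive semidefinite but not definite.\<close>

definition perm_inner :: "(('a::finite \<Rightarrow> 'a) \<Rightarrow> 'v::real_inner) \<Rightarrow> (('a \<Rightarrow> 'a) \<Rightarrow> 'v) \<Rightarrow> real" where
  "perm_inner f g = (\<Sum>P | bij P. inner (f P) (g P))"

lemma sum_bij_transpose:
  fixes f :: "('a \<Rightarrow> 'a) \<Rightarrow> 'v::comm_monoid_add"
  shows "(\<Sum>P | bij P. f (P \<circ> transposition s t)) = (\<Sum>P | bij P. f P)"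
proof (rule sum.reindex_bij_witness[of _ "\<lambda>P. P \<circ> transposition s t"
      "\<lambda>P. P \<circ> transposition s t"])
qed (auto simp: comp_assoc intro: bij_comp)

lemma perm_inner_swap_lap:
  "perm_inner f (swap_lap g)
    = (\<Sum>s\<in>UNIV. \<Sum>t\<in>UNIV. \<Sum>P | bij P. inner (f P) (g P - g (P \<circ> transposition s t)))"
  unfolding perm_inner_def swap_lap_def inner_sum_right
  by (subst sum.swap, rule sum.cong[OF refl], subst sum.swap, rule refl)

text \<open>Substituting \<open>P \<circ> transposition s t\<close> for \<open>P\<close> moves the
  transposition to the other argument, since it is an involution.\<close>

lemma perm_inner_swap_lap_commute: "perm_inner (swap_lap f) g = perm_inner f (swap_lap g)"
proof -
  have "(\<Sum>P | bij P. inner (f (P \<circ> transposition s t)) (g P))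
      = (\<Sum>P | bij P. inner (f P) (g (P \<circ> transposition s t)))" for s t
    by (subst sum_bij_transpose[symmetric, of _ s t]) (simp add: comp_assoc)
  then have "perm_inner g (swap_lap f) = perm_inner f (swap_lap g)"
    by (simp only: perm_inner_swap_lap inner_diff_right sum_subtractf inner_commute[of "g _" "f _"])
  then show ?thesis
    by (simp add: perm_inner_def inner_commute)
qed

text \<open>Each transposition acts as an isometry, so expanding the square gives twice the inner
  product of \<open>f\<close> with the difference. This is the Dirichlet form of the
  Laplacian.\<close>

lemma perm_inner_swap_lap_self:
  "2 * perm_inner f (swap_lap f)
    = (\<Sum>s\<in>UNIV. \<Sum>t\<in>UNIV. \<Sum>P | bij P. (norm (f P - f (P \<circ> transposition s t)))\<^sup>2)"
proof -
  have "2 * (\<Sum>P | bij P. inner (f P) (f P - f (P \<circ> transposition s t)))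
      = (\<Sum>P | bij P. (norm (f P - f (P \<circ> transposition s t)))\<^sup>2)" for s t
  proof -
    have "(\<Sum>P | bij P. (norm (f P - f (P \<circ> transposition s t)))\<^sup>2)
      = (\<Sum>P | bij P. inner (f P) (f P))
        + (\<Sum>P | bij P. inner (f (P \<circ> transposition s t)) (f (P \<circ> transposition s t)))
        - 2 * (\<Sum>P | bij P. inner (f P) (f (P \<circ> transposition s t)))"
      by (simp add: power2_norm_eq_inner inner_diff inner_commute sum_distrib_left
          flip: sum.distrib sum_subtractf)
    also have "(\<Sum>P | bij P. inner (f (P \<circ> transposition s t)) (f (P \<circ> transposition s t)))
       = (\<Sum>P | bij P. inner (f P) (f P))"
      by (rule sum_bij_transpose)
    finally show ?thesis
      by (simp add: inner_diff_right sum_subtractf comp_def)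
  qed
  then show ?thesis
    unfolding perm_inner_swap_lap sum_distrib_left by simp
qed

lemma perm_inner_nonneg: "0 \<le> perm_inner f f"
  by (simp add: perm_inner_def sum_nonneg)

lemma perm_inner_Cauchy_Schwarz: "(perm_inner f g)\<^sup>2 \<le> perm_inner f f * perm_inner g g"
proof -
  have "\<bar>perm_inner f g\<bar> \<le> (\<Sum>P | bij P. \<bar>norm (f P)\<bar> * \<bar>norm (g P)\<bar>)"
    unfolding perm_inner_def
    by (rule order.trans[OF sum_abs]) (auto intro!: sum_mono Cauchy_Schwarz_ineq2)
  also have "\<dots> \<le> L2_set (\<lambda>P. norm (f P)) {P. bij P} * L2_set (\<lambda>P. norm (g P)) {P. bij P}"
    by (rule L2_set_mult_ineq)
  finally have "\<bar>perm_inner f g\<bar>\<^sup>2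
      \<le> (L2_set (\<lambda>P. norm (f P)) {P. bij P} * L2_set (\<lambda>P. norm (g P)) {P. bij P})\<^sup>2"
    by (intro power_mono) auto
  also have "\<dots> = perm_inner f f * perm_inner g g"
    by (simp add: L2_set_def power_mult_distrib sum_nonneg perm_inner_def power2_norm_eq_inner)
  finally show ?thesis
    by simp
qed

text \<open>Otherwise \<open>K * (r / x) ^ (2 ^ j)\<close> would tend to 0 while staying at least 1.
  Exponents are powers of two because repeated squaring produces them.\<close>

lemma geometric_growth_le:
  fixes x r K :: real
  assumes "0 \<le> r" "\<And>j. x ^ (2 ^ j) \<le> K * r ^ (2 ^ j)"
  shows "x \<le> r"
proof (rule ccontr)
  assume "\<not> x \<le> r"
  then have x: "r < x" "0 < x"
    using assms(1) by auto
  have "1 \<le> K * (r / x) ^ (2 ^ j)" for j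
    using assms(2)[of j] x by (simp add: power_divide field_simps)
  moreover have "(\<lambda>j. K * (r / x) ^ (2 ^ j)) \<longlonglongrightarrow> K * 0"
  proof (intro tendsto_mult_left)
    have "(\<lambda>j. (r / x) ^ j) \<longlonglongrightarrow> 0"
      using x assms(1) by (intro LIMSEQ_power_zero) auto
    moreover have "strict_mono (\<lambda>j. 2 ^ j :: nat)"
      by (auto simp: strict_mono_def)
    ultimately show "(\<lambda>j. (r / x) ^ (2 ^ j)) \<longlonglongrightarrow> 0"
      using LIMSEQ_subseq_LIMSEQ[of "\<lambda>j. (r / x) ^ j" 0 "\<lambda>j. 2 ^ j"] by (simp add: comp_def)
  qed
  ultimately have "1 \<le> K * 0"
    by (intro LIMSEQ_le_const[where a = 1]) auto
  then show False
    by simp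
qed

text \<open>Power iteration in place of the spectral theorem: iterating Cauchy--Schwarz bounds
  \<open>(a 1 / n) ^ 2 ^ j\<close> by \<open>a (2 ^ j) / n\<close>, where \<open>a k\<close> is the inner product of \<open>f\<close> with the \<open>k\<close>-th
  iterate, and \<open>a k\<close> grows at most like \<open>(4 q N) ^ k\<close>.\<close>
lemma perm_inner_swap_lap_le:
  fixes f :: "('a::finite \<Rightarrow> 'a) \<Rightarrow> 'v::real_inner"
  assumes "poly_bound q C f"
  shows "perm_inner f (swap_lap f) \<le> 4 * real q * real CARD('a) * perm_inner f f"
proof -
  define r where "r = 4 * real q * real CARD('a)"
  define n where "n = perm_inner f f"
  define a where "a k = perm_inner f ((swap_lap ^^ k) f)" for k
  have r: "0 \<le> r"
    by (simp add: r_def)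
  have C: "0 \<le> C"
    using norm_le_poly_bound[OF assms, of id] norm_ge_zero order.trans by blast
  \<comment> \<open>Each application of \<open>swap_lap\<close> keeps the degree and costs a factor
    \<open>r\<close> in the coefficients.\<close>
  have "\<exists>C'\<le>r ^ k * C. poly_bound q C' ((swap_lap ^^ k) f)" for k
  proof (induction k)
    case 0
    then show ?case
      using assms by auto
  next
    case (Suc k)
    then obtain C' where C': "C' \<le> r ^ k * C" "poly_bound q C' ((swap_lap ^^ k) f)"
      by blast
    have "4 * real q * real CARD('a) * C' \<le> r ^ Suc k * C"
      using mult_left_mono[OF C'(1) r] by (simp add: r_def mult.assoc)
    with poly_bound_swap_lap[OF C'(2)] show ?case
      by (auto intro: order.trans)
  qed
  then have *: "norm ((swap_lap ^^ k) f P) \<le> r ^ k * C" for k P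
    using norm_le_poly_bound order.trans by blast
  have upper: "a k \<le> (\<Sum>P | bij P. norm (f P)) * C * r ^ k" for k
  proof -
    have "a k \<le> (\<Sum>P | bij P. norm (f P) * (r ^ k * C))"
      unfolding a_def perm_inner_def
      by (intro sum_mono order.trans[OF norm_cauchy_schwarz] mult_left_mono *) auto
    then show ?thesis
      by (simp add: sum_distrib_left sum_distrib_right mult_ac)
  qed
  show ?thesis
  \<comment> \<open>The degenerate case is split off before dividing by \<open>n\<close>; there
    Cauchy-Schwarz makes the form vanish.\<close>
  proof (cases "n = 0")
    case True
    then have "(perm_inner f (swap_lap f))\<^sup>2 \<le> 0"
      using perm_inner_Cauchy_Schwarz[of f "swap_lap f"] by (simp add: n_def)
    with True show ?thesis
      by (simp add: n_def)
  next
    case False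
    then have n: "0 < n"
      using perm_inner_nonneg[of f] by (simp add: n_def)
    have shift: "perm_inner ((swap_lap ^^ k) f) g = perm_inner f ((swap_lap ^^ k) g)" for k g
      by (induction k arbitrary: g)
        (simp_all add: perm_inner_swap_lap_commute flip: funpow_swap1)
    \<comment> \<open>By self-adjointness, the squared norm of the \<open>k\<close>-th iterate is
      \<open>a (2 * k)\<close>.\<close>
    have double: "(a k)\<^sup>2 \<le> n * a (2 * k)" for k
      using perm_inner_Cauchy_Schwarz[of f "(swap_lap ^^ k) f"]
      by (simp add: a_def n_def shift mult_2 funpow_add)
    have "a 1 / n \<le> r"
    proof (rule geometric_growth_le[OF r])
      fix j :: nat
      have "(a 1 / n) ^ (2 ^ j) \<le> a (2 ^ j) / n"
      proof (cases j)
        case 0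
        then show ?thesis by simp
      next
        case (Suc i)
        \<comment> \<open>The induction starts at exponent 2: squaring the hypothesis needs a
          nonnegative left side, which an even power provides whatever the sign of
          \<open>a 1\<close>.\<close>
        have "(a 1 / n) ^ (2 ^ Suc i) \<le> a (2 ^ Suc i) / n" for i
        proof (induction i)
          case 0
          then show ?case
            using double[of 1] n by (simp add: power_divide power2_eq_square field_simps)
        next
          case (Suc i)
          have "(a 1 / n) ^ (2 ^ Suc (Suc i)) = ((a 1 / n) ^ (2 ^ Suc i))\<^sup>2"
            by (simp flip: power_mult add: mult.commute)
          also have "\<dots> \<le> (a (2 ^ Suc i) / n)\<^sup>2"
            by (intro power_mono Suc.IH) simp
          also have "\<dots> \<le> a (2 ^ Suc (Suc i)) / n"
            using double[of "2 ^ Suc i"] n by (simp add: power_divide power2_eq_square field_simps)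
          finally show ?case .
        qed
        then show ?thesis
          by (simp add: Suc)
      qed
      also have "\<dots> \<le> (\<Sum>P | bij P. norm (f P)) * C / n * r ^ (2 ^ j)"
        using upper[of "2 ^ j"] n by (simp add: field_simps)
      finally show "(a 1 / n) ^ (2 ^ j) \<le> (\<Sum>P | bij P. norm (f P)) * C / n * r ^ (2 ^ j)" .
    qed
    then show ?thesis
      using n by (simp add: a_def n_def r_def field_simps)
  qed
qed

section \<open>Low-degree functions under a random transposition\<close>

text \<open>Agreement is asked for on bijections only, because the condition
  \<open>inv P x = y\<close> can be replaced by \<open>P y = x\<close> there.\<close>

definition low_degree :: "nat \<Rightarrow> (('a \<Rightarrow> 'a) \<Rightarrow> 'v::real_normed_vector) \<Rightarrow> bool" where
  "low_degree q g \<longleftrightarrow> (\<exists>C f. poly_bound q C f \<and> (\<forall>P. bij P \<longrightarrow> g P = f P))"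

lemma low_degree_const: "low_degree q (\<lambda>P. v)"
  unfolding low_degree_def using poly_bound_const by blast

lemma low_degree_cong: "low_degree q f \<Longrightarrow> (\<And>P. bij P \<Longrightarrow> g P = f P) \<Longrightarrow> low_degree q g"
  by (auto simp: low_degree_def)

lemma low_degree_sum:
  assumes "\<And>i. i \<in> I \<Longrightarrow> low_degree q (f i)"
  shows "low_degree q (\<lambda>P. \<Sum>i\<in>I. f i P)"
proof -
  from assms obtain C h where
    "\<forall>i\<in>I. poly_bound q (C i) (h i) \<and> (\<forall>P. bij P \<longrightarrow> f i P = h i P)"
    unfolding low_degree_def by metis
  then show ?thesis
    unfolding low_degree_def
    by (intro exI[of _ "sum C I"] exI[of _ "\<lambda>P. \<Sum>i\<in>I. h i P"]) (auto intro: poly_bound_sum)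
qed

lemma low_degree_linear:
  assumes "low_degree q f" "bounded_linear T"
  shows "low_degree q (\<lambda>P. T (f P))"
proof -
  obtain C h where "poly_bound q C h" "\<forall>P. bij P \<longrightarrow> f P = h P"
    using assms(1) by (auto simp: low_degree_def)
  with poly_bound_linear[OF this(1) assms(2)] show ?thesis
    by (fastforce simp: low_degree_def)
qed

lemma low_degree_mult:
  assumes "low_degree q f"
  shows "low_degree (Suc q) (\<lambda>P. monomial {(x, y)} (f P) P)"
proof -
  obtain C h where "poly_bound q C h" "\<forall>P. bij P \<longrightarrow> f P = h P"
    using assms by (auto simp: low_degree_def)
  with poly_bound_mult[OF this(1), of x y] show ?thesis
    by (fastforce simp: low_degree_def)
qed

text \<open>The factor 8 is twice the 4 of \<open>perm_inner_swap_lap_le\<close>, by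
  \<open>perm_inner_swap_lap_self\<close>. Passing to a polynomial is sound since
  \<open>P \<circ> transposition s t\<close> is again a bijection.\<close>

lemma sum_norm_swap_diff_le:
  fixes f :: "('a::finite \<Rightarrow> 'a) \<Rightarrow> 'v::real_inner"
  assumes "low_degree q f"
  shows "(\<Sum>s\<in>UNIV. \<Sum>t\<in>UNIV. \<Sum>P | bij P. (norm (f P - f (P \<circ> transposition s t)))\<^sup>2)
    \<le> 8 * real q * real CARD('a) * (\<Sum>P | bij P. (norm (f P))\<^sup>2)"
proof -
  obtain C h where h: "poly_bound q C h" "\<And>P. bij P \<Longrightarrow> f P = h P"
    using assms by (auto simp: low_degree_def)
  have "bij P \<Longrightarrow> f (P \<circ> transposition s t) = h (P \<circ> transposition s t)" for P s t
    by (intro h(2) bij_comp) auto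
  moreover have "(\<Sum>s\<in>UNIV. \<Sum>t\<in>UNIV. \<Sum>P | bij P. (norm (h P - h (P \<circ> transposition s t)))\<^sup>2)
      \<le> 8 * real q * real CARD('a) * (\<Sum>P | bij P. (norm (h P))\<^sup>2)"
    using perm_inner_swap_lap_le[OF h(1)] unfolding perm_inner_swap_lap_self[symmetric]
    by (simp add: perm_inner_def power2_norm_eq_inner)
  ultimately show ?thesis
    by (simp add: h(2))
qed

text \<open>Cauchy-Schwarz over all triples \<open>(s, t, P)\<close>. The hypothesis on
  \<open>G\<close> is the continuity estimate of a quadratic form of operator norm at most 1;
  keeping \<open>norm (u + v)\<close> makes the bound proportional to squared norms, which add up
  over measurement branches.\<close>

lemma sum_swap_perturb_le:
  fixes f :: "('a::finite \<Rightarrow> 'a) \<Rightarrow> 'v::real_inner" and G :: "('a \<Rightarrow> 'a) \<Rightarrow> 'a \<Rightarrow> 'a \<Rightarrow> 'v \<Rightarrow> real"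
  assumes "low_degree q f"
    and G: "\<And>P s t u v. \<bar>G P s t u - G P s t v\<bar> \<le> norm (u - v) * norm (u + v)"
  shows "\<bar>\<Sum>s\<in>UNIV. \<Sum>t\<in>UNIV. \<Sum>P | bij P. G P s t (f P) - G P s t (f (P \<circ> transposition s t))\<bar>
    \<le> sqrt (32 * real q * real CARD('a) ^ 3) * (\<Sum>P | bij P. (norm (f P))\<^sup>2)"
proof -
  define I where "I = (UNIV :: 'a set) \<times> (UNIV :: 'a set) \<times> {P :: 'a \<Rightarrow> 'a. bij P}"
  define f' where "f' s t P = f (P \<circ> transposition s t)" for s t P
  define n where "n = (\<Sum>P | bij P. (norm (f P))\<^sup>2)"
  have I: "(\<Sum>s\<in>UNIV. \<Sum>t\<in>UNIV. \<Sum>P | bij P. h s t P) = (\<Sum>(s, t, P)\<in>I. h s t P)"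
    for h :: "'a \<Rightarrow> 'a \<Rightarrow> ('a \<Rightarrow> 'a) \<Rightarrow> real"
    by (simp add: I_def sum.cartesian_product case_prod_unfold)
  have n: "0 \<le> n"
    by (simp add: n_def sum_nonneg)
  have "(\<Sum>(s, t, P)\<in>I. (norm (f P + f' s t P))\<^sup>2)
      \<le> (\<Sum>(s, t, P)\<in>I. 2 * (norm (f P))\<^sup>2 + 2 * (norm (f' s t P))\<^sup>2)"
  proof (intro sum_mono, clarify)
    fix s t P
    have "0 \<le> (norm (f P - f' s t P))\<^sup>2"
      by simp
    then show "(norm (f P + f' s t P))\<^sup>2 \<le> 2 * (norm (f P))\<^sup>2 + 2 * (norm (f' s t P))\<^sup>2"
      unfolding power2_norm_eq_inner
      by (simp add: inner_diff inner_add inner_commute)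
  qed
  also have "\<dots> = (\<Sum>s\<in>(UNIV::'a set). \<Sum>t\<in>(UNIV::'a set).
      2 * n + 2 * (\<Sum>P | bij P. (norm (f' s t P))\<^sup>2))"
    by (simp add: I[symmetric] sum.distrib n_def flip: sum_distrib_left)
  also have "\<dots> = 4 * (real CARD('a))\<^sup>2 * n"
    unfolding f'_def sum_bij_transpose[of "\<lambda>P. (norm (f P))\<^sup>2"] n_def[symmetric]
    by (simp add: power2_eq_square)
  \<comment> \<open>The parallelogram law gives twice each squared norm, and for every pair
    \<open>(s, t)\<close> both families of squared norms sum to \<open>n\<close>.\<close>
  finally have plus: "(\<Sum>(s, t, P)\<in>I. (norm (f P + f' s t P))\<^sup>2) \<le> 4 * (real CARD('a))\<^sup>2 * n" .
  have minus: "(\<Sum>(s, t, P)\<in>I. (norm (f P - f' s t P))\<^sup>2) \<le> 8 * real q * real CARD('a) * n"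
    using sum_norm_swap_diff_le[OF assms(1)] by (simp add: I f'_def n_def)
  have "\<bar>\<Sum>(s, t, P)\<in>I. G P s t (f P) - G P s t (f' s t P)\<bar>
      \<le> (\<Sum>(s, t, P)\<in>I. \<bar>norm (f P - f' s t P)\<bar> * \<bar>norm (f P + f' s t P)\<bar>)"
    by (rule order.trans[OF sum_abs]) (auto intro!: sum_mono G)
  also have "\<dots> \<le> L2_set (\<lambda>(s, t, P). norm (f P - f' s t P)) I
      * L2_set (\<lambda>(s, t, P). norm (f P + f' s t P)) I"
    using L2_set_mult_ineq[of "\<lambda>(s, t, P). norm (f P - f' s t P)"
        "\<lambda>(s, t, P). norm (f P + f' s t P)" I]
    by (simp add: case_prod_unfold)
  also have "\<dots> \<le> sqrt (8 * real q * real CARD('a) * n) * sqrt (4 * (real CARD('a))\<^sup>2 * n)"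
    using plus minus by (intro mult_mono) (auto simp: L2_set_def case_prod_unfold sum_nonneg n)
  also have "\<dots> = sqrt (32 * real q * real CARD('a) ^ 3 * n\<^sup>2)"
    by (simp flip: real_sqrt_mult add: power2_eq_square power3_eq_cube)
  also have "\<dots> = sqrt (32 * real q * real CARD('a) ^ 3) * n"
    using n by (simp add: real_sqrt_mult)
  finally show ?thesis
    by (simp add: I f'_def n_def)
qed

section \<open>States and queries\<close>

lemma norm_vec_complex: "(norm (v :: complex ^ 'd))\<^sup>2 = (\<Sum>i\<in>UNIV. (cmod (v $ i))\<^sup>2)"
  by (simp add: norm_vec_def L2_set_def sum_nonneg)

lemma norm_unitary:
  fixes U :: "complex ^ 'd ^ 'd"
  assumes "unitary_mat U"
  shows "norm (U *v v) = norm v"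
proof -
  have *: "(\<Sum>i\<in>UNIV. cnj (U $ i $ k) * U $ i $ j) = (if k = j then 1 else 0)" for j k
    using assms
    by (simp add: unitary_mat_def adjoint_mat_def matrix_matrix_mult_def vec_eq_iff mat_def)
  have "complex_of_real ((norm (U *v v))\<^sup>2) = (\<Sum>i\<in>UNIV. (U *v v) $ i * cnj ((U *v v) $ i))"
    by (simp add: norm_vec_complex complex_norm_square del: of_real_power)
  also have "\<dots> = (\<Sum>i\<in>UNIV. \<Sum>j\<in>UNIV. \<Sum>k\<in>UNIV. v $ j * cnj (v $ k) * (cnj (U $ i $ k) * U $ i $ j))"
    by (simp add: matrix_vector_mult_def sum_product cnj_sum mult_ac)
  also have "\<dots> = (\<Sum>j\<in>UNIV. \<Sum>k\<in>UNIV. v $ j * cnj (v $ k) * (\<Sum>i\<in>UNIV. cnj (U $ i $ k) * U $ i $ j))"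
    unfolding sum_distrib_left
    by (subst sum.swap, rule sum.cong[OF refl], subst sum.swap, rule refl)
  also have "\<dots> = (\<Sum>j\<in>UNIV. v $ j * cnj (v $ j))"
    by (simp add: * if_distrib cong: if_cong)
  also have "\<dots> = complex_of_real ((norm v)\<^sup>2)"
    by (simp add: norm_vec_complex complex_norm_square del: of_real_power)
  finally have "(norm (U *v v))\<^sup>2 = (norm v)\<^sup>2"
    by (simp only: of_real_eq_iff)
  then show ?thesis
    by simp
qed

lemma matrix_vector_mult_scaleR: "(U :: complex ^ 'd ^ 'e) *v (k *\<^sub>R v) = k *\<^sub>R (U *v v)"
  by (simp add: vec_eq_iff matrix_vector_mult_def scaleR_sum_right)

lemma bounded_linear_matrix_vector_mult:
  "bounded_linear (\<lambda>v. (U :: complex ^ 'd ^ 'e) *v v)"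
  unfolding linear_conv_bounded_linear[symmetric]
  by (intro linearI) (simp_all add: matrix_vector_right_distrib matrix_vector_mult_scaleR)

lemma proj_onto_scaleR: "proj_onto A (k *\<^sub>R v) = k *\<^sub>R proj_onto A v"
  by (simp add: proj_onto_def vec_eq_iff)

lemma proj_onto_add: "proj_onto A (u + v) = proj_onto A u + proj_onto A v"
  by (simp add: proj_onto_def vec_eq_iff)

lemma proj_onto_diff: "proj_onto A (u - v) = proj_onto A u - proj_onto A v"
  by (simp add: proj_onto_def vec_eq_iff)

lemma bounded_linear_proj_onto: "bounded_linear (proj_onto A)"
  unfolding linear_conv_bounded_linear[symmetric]
  by (intro linearI) (simp_all add: proj_onto_add proj_onto_scaleR)

lemma norm_proj_onto_Pythagoras:
  "(norm (proj_onto A v))\<^sup>2 + (norm (proj_onto (- A) v))\<^sup>2 = (norm v)\<^sup>2"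
  unfolding norm_vec_complex sum.distrib[symmetric]
  by (intro sum.cong) (auto simp: proj_onto_def)

lemma xor_bits_cancel [simp]: "(x \<oplus> y) \<oplus> y = x"
  by (auto simp: xor_bits_def vec_eq_iff)

text \<open>XOR with \<open>f x\<close> is its own inverse, so amplitudes are pulled back along the
  same map that moves the basis states.\<close>

lemma query_mat_apply: "(query_mat f *v \<psi>) $ (w, x, y) = \<psi> $ (w, x, y \<oplus> f x)"
proof -
  have "query_mat f $ (w, x, y) $ j * \<psi> $ j = (if j = (w, x, y \<oplus> f x) then \<psi> $ j else 0)" for j
    by (cases j) (auto simp: query_mat_def)
  then have "(query_mat f *v \<psi>) $ (w, x, y)
      = (\<Sum>j\<in>UNIV. if j = (w, x, y \<oplus> f x) then \<psi> $ j else 0)"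
    by (simp add: matrix_vector_mult_def)
  then show ?thesis
    by simp
qed

lemma norm_query_mat: "norm (query_mat f *v \<psi>) = norm \<psi>"
proof -
  have "(norm (query_mat f *v \<psi>))\<^sup>2 = (norm \<psi>)\<^sup>2"
    unfolding norm_vec_complex
    by (rule sum.reindex_bij_witness[of _ "\<lambda>(w, x, y). (w, x, y \<oplus> f x)"
          "\<lambda>(w, x, y). (w, x, y \<oplus> f x)"])
      (auto simp: query_mat_apply)
  then show ?thesis
    by simp
qed

text \<open>Splitting by query input and answer writes the query as fixed linear maps weighted by
  indicators of \<open>f x = y\<close>, hence as a polynomial of degree 1 in
  \<open>f\<close>.\<close>

lemma query_mat_expand:
  "query_mat f *v \<psi> = (\<Sum>x\<in>UNIV. \<Sum>y\<in>UNIV. if f x = y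
     then query_mat (\<lambda>_. y) *v proj_onto {i. fst (snd i) = x} \<psi> else 0)"
proof -
  have "(query_mat f *v \<psi>) $ (w, x, y)
      = (\<Sum>x'\<in>UNIV. query_mat (\<lambda>_. f x') *v proj_onto {i. fst (snd i) = x'} \<psi>) $ (w, x, y)" for w x y
    by (simp add: query_mat_apply proj_onto_def)
  then show ?thesis
    by (simp add: vec_eq_iff[where x = "query_mat f *v \<psi>"])
qed

lemma low_degree_query:
  assumes "low_degree q g"
  shows "low_degree (Suc q) (\<lambda>P. query_mat P *v g P)"
proof (rule low_degree_cong)
  show "low_degree (Suc q) (\<lambda>P. \<Sum>x\<in>UNIV. \<Sum>y\<in>UNIV.
      monomial {(x, y)} (query_mat (\<lambda>_. y) *v proj_onto {i. fst (snd i) = x} (g P)) P)"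
    by (intro low_degree_sum low_degree_mult
        low_degree_linear[OF _ bounded_linear_matrix_vector_mult]
        low_degree_linear[OF _ bounded_linear_proj_onto] assms)
qed (subst query_mat_expand, simp add: monomial_def)

text \<open>For a bijection, \<open>inv P x = y\<close> means \<open>P y = x\<close>, so an inverse
  query uses monomials with the pair reversed and also costs one degree.\<close>

lemma low_degree_query_inv:
  fixes g :: "('n::finite bits \<Rightarrow> 'n bits) \<Rightarrow> ('w::finite, 'n) qstate"
  assumes "low_degree q g"
  shows "low_degree (Suc q) (\<lambda>P. query_mat (inv P) *v g P)"
proof (rule low_degree_cong)
  show "low_degree (Suc q) (\<lambda>P. \<Sum>x\<in>UNIV. \<Sum>y\<in>UNIV.
      monomial {(y, x)} (query_mat (\<lambda>_. y) *v proj_onto {i. fst (snd i) = x} (g P)) P)"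
    by (intro low_degree_sum low_degree_mult
        low_degree_linear[OF _ bounded_linear_matrix_vector_mult]
        low_degree_linear[OF _ bounded_linear_proj_onto] assms)
next
  fix P :: "'n bits \<Rightarrow> 'n bits"
  assume "bij P"
  then have "(inv P x = y) = (P y = x)" for x y
    by (metis bij_inv_eq_iff)
  then show "query_mat (inv P) *v g P = (\<Sum>x\<in>UNIV. \<Sum>y\<in>UNIV.
      monomial {(y, x)} (query_mat (\<lambda>_. y) *v proj_onto {i. fst (snd i) = x} (g P)) P)"
    by (subst query_mat_expand) (simp add: monomial_def)
qed

text \<open>Sums \<open>F\<close> over all measurement branches, with states collapsed but not normalised. Unlike
  the states in \<open>run\<close>, these depend linearly on the initial state.\<close>
primrec leaf_sum :: "('n::finite bits \<Rightarrow> 'n bits) \<Rightarrow> ('r, 'w::finite, 'n) qalg \<Rightarrow>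
    ('r \<Rightarrow> ('w, 'n) qstate \<Rightarrow> real) \<Rightarrow> ('w, 'n) qstate \<Rightarrow> real" where
  "leaf_sum P (Return r) F \<psi> = F r \<psi>"
| "leaf_sum P (Unitary U c) F \<psi> = leaf_sum P c F (U *v \<psi>)"
| "leaf_sum P (Query c) F \<psi> = leaf_sum P c F (query_mat P *v \<psi>)"
| "leaf_sum P (Query_Inv c) F \<psi> = leaf_sum P c F (query_mat (inv P) *v \<psi>)"
| "leaf_sum P (Measure A c d) F \<psi> =
     leaf_sum P c F (proj_onto A \<psi>) + leaf_sum P d F (proj_onto (- A) \<psi>)"

lemma leaf_sum_sum: "leaf_sum P c (\<lambda>r \<phi>. \<Sum>i\<in>I. F i r \<phi>) \<psi> = (\<Sum>i\<in>I. leaf_sum P c (F i) \<psi>)"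
  by (induction c arbitrary: \<psi>) (simp_all add: sum.distrib)

lemma leaf_sum_divide: "leaf_sum P c (\<lambda>r \<phi>. F r \<phi> / k) \<psi> = leaf_sum P c F \<psi> / k"
  by (induction c arbitrary: \<psi>) (simp_all add: add_divide_distrib)

text \<open>Unitaries and queries preserve norms and measurements split them by Pythagoras, so the
  squared norms at all leaves sum to that of the initial state.\<close>

lemma leaf_sum_split:
  assumes "wf_qalg c" "\<And>r \<phi>. F r \<phi> = ((norm \<phi>)\<^sup>2 + G r \<phi>) / 2"
  shows "leaf_sum P c F \<psi> = ((norm \<psi>)\<^sup>2 + leaf_sum P c G \<psi>) / 2"
  using assms(1)
  by (induction c arbitrary: \<psi>)
    (simp_all add: assms(2) norm_unitary norm_query_mat field_simps norm_proj_onto_Pythagoras)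

lemma leaf_sum_scaleR:
  assumes "\<And>r k \<phi>. F r (k *\<^sub>R \<phi>) = k\<^sup>2 * F r \<phi>"
  shows "leaf_sum P c F (k *\<^sub>R \<psi>) = k\<^sup>2 * leaf_sum P c F \<psi>"
  by (induction c arbitrary: \<psi>)
    (simp_all add: assms matrix_vector_mult_scaleR proj_onto_scaleR distrib_left)

text \<open>Unitaries and queries are linear isometries; at a measurement, Cauchy-Schwarz in the
  plane and Pythagoras recombine the bounds of the two branches.\<close>

lemma leaf_sum_perturb:
  assumes "wf_qalg c" "\<And>r u v. \<bar>F r u - F r v\<bar> \<le> norm (u - v) * norm (u + v)"
  shows "\<bar>leaf_sum P c F u - leaf_sum P c F v\<bar> \<le> norm (u - v) * norm (u + v)"
  using assms(1)
proof (induction c arbitrary: u v)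
  case (Return r)
  then show ?case
    by (simp add: assms(2))
next
  case (Unitary U c)
  then show ?case
    using Unitary.IH[of "U *v u" "U *v v"]
    by (simp add: norm_unitary flip: matrix_vector_mult_diff_distrib matrix_vector_right_distrib)
next
  case (Query c)
  then show ?case
    using Query.IH[of "query_mat P *v u" "query_mat P *v v"]
    by (simp add: norm_query_mat flip: matrix_vector_mult_diff_distrib matrix_vector_right_distrib)
next
  case (Query_Inv c)
  then show ?case
    using Query_Inv.IH[of "query_mat (inv P) *v u" "query_mat (inv P) *v v"]
    by (simp add: norm_query_mat flip: matrix_vector_mult_diff_distrib matrix_vector_right_distrib)
next
  case (Measure A c d)
  define x where "x B = norm (proj_onto B (u - v))" for B
  define y where "y B = norm (proj_onto B (u + v))" for B
  have "\<bar>leaf_sum P (Measure A c d) F u - leaf_sum P (Measure A c d) F v\<bar>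
      \<le> x A * y A + x (- A) * y (- A)"
    using Measure.IH(1)[of "proj_onto A u" "proj_onto A v"]
      Measure.IH(2)[of "proj_onto (- A) u" "proj_onto (- A) v"] Measure.prems
    by (simp add: x_def y_def proj_onto_diff proj_onto_add)
  also have "\<dots> \<le> sqrt ((x A)\<^sup>2 + (x (- A))\<^sup>2) * sqrt ((y A)\<^sup>2 + (y (- A))\<^sup>2)"
    unfolding real_sqrt_mult[symmetric]
  proof (rule real_le_rsqrt)
    \<comment> \<open>Lagrange's identity: this square is the difference of the two sides.\<close>
    have "0 \<le> (x A * y (- A) - x (- A) * y A)\<^sup>2"
      by simp
    then show "(x A * y A + x (- A) * y (- A))\<^sup>2
        \<le> ((x A)\<^sup>2 + (x (- A))\<^sup>2) * ((y A)\<^sup>2 + (y (- A))\<^sup>2)"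
      by (simp add: power2_eq_square algebra_simps)
  qed
  also have "\<dots> = norm (u - v) * norm (u + v)"
    by (simp add: x_def y_def norm_proj_onto_Pythagoras)
  finally show ?case .
qed

text \<open>The induction carries the collapsed state reached so far as a function \<open>f\<close>
  of \<open>P\<close>, with \<open>k\<close> accounting for the queries already made.
  \<open>G\<close> sees \<open>P\<close> in both terms, so only the algorithm \<open>c\<close> is
  run with the swapped permutation. At a measurement the bounds add because the squared norms
  do.\<close>

lemma leaf_sum_swap_le:
  fixes G :: "('n bits \<Rightarrow> 'n bits) \<Rightarrow> 'n bits \<Rightarrow> 'n bits \<Rightarrow> 'r \<Rightarrow> ('w::finite, 'n::finite) qstate \<Rightarrow> real"
  assumes G: "\<And>P s t r u v. \<bar>G P s t r u - G P s t r v\<bar> \<le> norm (u - v) * norm (u + v)"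
  assumes "wf_qalg c" "low_degree k f" "k + num_queries c \<le> q"
  shows "\<bar>\<Sum>s\<in>UNIV. \<Sum>t\<in>UNIV. \<Sum>P | bij P.
      leaf_sum P c (G P s t) (f P) - leaf_sum (P \<circ> swap s t) c (G P s t) (f (P \<circ> swap s t))\<bar>
    \<le> sqrt (32 * real q * real CARD('n bits) ^ 3) * (\<Sum>P | bij P. (norm (f P))\<^sup>2)"
  using assms(2-)
proof (induction c arbitrary: k f)
  case (Return r)
  have "\<bar>\<Sum>s\<in>UNIV. \<Sum>t\<in>UNIV. \<Sum>P | bij P. G P s t r (f P) - G P s t r (f (P \<circ> swap s t))\<bar>
    \<le> sqrt (32 * real k * real CARD('n bits) ^ 3) * (\<Sum>P | bij P. (norm (f P))\<^sup>2)"
    using Return.prems G by (intro sum_swap_perturb_le)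
  also have "\<dots> \<le> sqrt (32 * real q * real CARD('n bits) ^ 3) * (\<Sum>P | bij P. (norm (f P))\<^sup>2)"
    using Return.prems
    by (intro mult_right_mono real_sqrt_le_mono mult_left_mono sum_nonneg) auto
  finally show ?case
    by (simp add: comp_def)
next
  case (Unitary U c)
  then show ?case
    using Unitary.IH[of k "\<lambda>P. U *v f P"]
    by (simp add: norm_unitary low_degree_linear[OF _ bounded_linear_matrix_vector_mult])
next
  case (Query c)
  then show ?case
    using Query.IH[of "Suc k" "\<lambda>P. query_mat P *v f P"]
    by (simp add: norm_query_mat low_degree_query)
next
  case (Query_Inv c)
  then show ?case
    using Query_Inv.IH[of "Suc k" "\<lambda>P. query_mat (inv P) *v f P"]
    by (simp add: norm_query_mat low_degree_query_inv)
next
  case (Measure A c d)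
  have low: "low_degree k (\<lambda>P. proj_onto B (f P))" for B
    using Measure.prems by (intro low_degree_linear[OF _ bounded_linear_proj_onto])
  have norm: "(\<Sum>P | bij P. (norm (f P))\<^sup>2)
      = (\<Sum>P | bij P. (norm (proj_onto A (f P)))\<^sup>2) + (\<Sum>P | bij P. (norm (proj_onto (- A) (f P)))\<^sup>2)"
    by (simp add: norm_proj_onto_Pythagoras flip: sum.distrib)
  show ?case
    unfolding norm distrib_left leaf_sum.simps add_diff_add sum.distrib
    using Measure.prems
    by (intro order.trans[OF abs_triangle_ineq] add_mono Measure.IH[OF _ low]) simp_all
qed

section \<open>Acceptance probabilities\<close>

lemma expectation_bind_finite:
  fixes h :: "'b \<Rightarrow> real"
  assumes "finite (set_pmf p)" "\<And>x. x \<in> set_pmf p \<Longrightarrow> finite (set_pmf (f x))"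
  shows "measure_pmf.expectation (bind_pmf p f) h
    = measure_pmf.expectation p (\<lambda>x. measure_pmf.expectation (f x) h)"
  using assms
  by (subst pmf_expectation_bind[OF assms(1)]) (auto simp: integral_measure_pmf[OF assms(1)])

lemma expectation_bind_uniform:
  fixes f :: "'a \<Rightarrow> 'b::finite pmf" and h :: "'b \<Rightarrow> real"
  assumes "A \<noteq> {}" "finite A"
  shows "measure_pmf.expectation (pmf_of_set A \<bind> f) h
    = (\<Sum>x\<in>A. measure_pmf.expectation (f x) h) / real (card A)"
  using assms by (subst expectation_bind_finite) (simp_all add: integral_pmf_of_set)

lemma finite_set_run: "finite (set_pmf (run P c \<psi>))"
  by (induction c arbitrary: \<psi>) (auto intro: finite_subset[OF subset_UNIV])

text \<open>Makes the parameter of \<open>bernoulli_pmf\<close> in \<open>run\<close> a genuine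
  probability, with the other outcome having the complementary Born weight.\<close>

lemma norm_proj_onto_unit:
  assumes "norm \<psi> = 1"
  shows "(norm (proj_onto A \<psi>))\<^sup>2 \<in> {0..1}"
    "(norm (proj_onto (- A) \<psi>))\<^sup>2 = 1 - (norm (proj_onto A \<psi>))\<^sup>2"
proof -
  have sum: "(norm (proj_onto A \<psi>))\<^sup>2 + (norm (proj_onto (- A) \<psi>))\<^sup>2 = 1"
    by (simp add: norm_proj_onto_Pythagoras assms)
  moreover have "0 \<le> (norm (proj_onto (- A) \<psi>))\<^sup>2"
    by (rule zero_le_power2)
  ultimately have "(norm (proj_onto A \<psi>))\<^sup>2 \<le> 1"
    by linarith
  then show "(norm (proj_onto A \<psi>))\<^sup>2 \<in> {0..1}"
    by simp
  show "(norm (proj_onto (- A) \<psi>))\<^sup>2 = 1 - (norm (proj_onto A \<psi>))\<^sup>2"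
    using sum by linarith
qed

text \<open>A branch in the support has positive probability, hence a nonzero projection, which
  \<open>sgn\<close> turns into a unit vector.\<close>

lemma norm_run:
  assumes "wf_qalg c" "norm \<psi> = 1" "(r, \<phi>) \<in> set_pmf (run P c \<psi>)"
  shows "norm \<phi> = 1"
  using assms
proof (induction c arbitrary: \<psi>)
  case (Return r')
  then show ?case
    by simp
next
  case (Unitary U c)
  then show ?case
    using Unitary.IH[of "U *v \<psi>"] by (simp add: norm_unitary)
next
  case (Query c)
  then show ?case
    using Query.IH[of "query_mat P *v \<psi>"] by (simp add: norm_query_mat)
next
  case (Query_Inv c)
  then show ?case
    using Query_Inv.IH[of "query_mat (inv P) *v \<psi>"] by (simp add: norm_query_mat)
next
  case (Measure A c d)
  let ?p = "(norm (proj_onto A \<psi>))\<^sup>2"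
  note unit = norm_proj_onto_unit[OF Measure.prems(2), of A]
  from Measure.prems(3) obtain b where b: "b \<in> set_pmf (bernoulli_pmf ?p)"
    and "(r, \<phi>) \<in> set_pmf (if b then run P c (sgn (proj_onto A \<psi>))
      else run P d (sgn (proj_onto (- A) \<psi>)))"
    by auto
  moreover have "proj_onto A \<psi> \<noteq> 0" if "b = True"
    using b unit that by (auto simp: set_pmf_iff)
  moreover have "proj_onto (- A) \<psi> \<noteq> 0" if "b = False"
    using b unit that by (auto simp: set_pmf_iff)
  ultimately show ?case
    using Measure.IH(1)[of "sgn (proj_onto A \<psi>)"] Measure.IH(2)[of "sgn (proj_onto (- A) \<psi>)"]
      Measure.prems(1)
    by (cases b) (auto simp: norm_sgn)
qed

text \<open>For quadratically homogeneous \<open>F\<close>, the Born weight times the value at the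
  normalised state is the value at the collapsed, unnormalised state.\<close>

lemma expectation_run:
  assumes "wf_qalg c" "norm \<psi> = 1" "\<And>r k \<phi>. F r (k *\<^sub>R \<phi>) = k\<^sup>2 * F r \<phi>"
  shows "measure_pmf.expectation (run P c \<psi>) (\<lambda>(r, \<phi>). F r \<phi>) = leaf_sum P c F \<psi>"
  using assms(1,2)
proof (induction c arbitrary: \<psi>)
  case (Measure A c d)
  have branch: "(norm v)\<^sup>2 * measure_pmf.expectation (run P e (sgn v)) (\<lambda>(r, \<phi>). F r \<phi>)
      = leaf_sum P e F v"
    if "\<And>\<psi>. norm \<psi> = 1 \<Longrightarrow>
      measure_pmf.expectation (run P e \<psi>) (\<lambda>(r, \<phi>). F r \<phi>) = leaf_sum P e F \<psi>" for e v
  \<comment> \<open>A zero projection has weight 0, and homogeneity with \<open>k = 0\<close> makes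
    its leaf sum 0 as well.\<close>
  proof (cases "v = 0")
    case True
    then show ?thesis
      using leaf_sum_scaleR[where F = F and P = P and c = e and k = 0 and \<psi> = 0, OF assms(3)]
      by simp
  next
    case False
    then have "leaf_sum P e F v = (norm v)\<^sup>2 * leaf_sum P e F (sgn v)"
      using leaf_sum_scaleR[where F = F and P = P and c = e and k = "norm v" and \<psi> = "sgn v",
          OF assms(3)]
      by (simp add: sgn_div_norm)
    with False that[of "sgn v"] show ?thesis
      by (simp add: norm_sgn)
  qed
  show ?case
    using Measure branch[of c "proj_onto A \<psi>"] branch[of d "proj_onto (- A) \<psi>"]
      norm_proj_onto_unit[of \<psi> A]
    by (simp, subst expectation_bind_finite)
      (auto simp: finite_set_run mult.commute intro: finite_subset[OF subset_UNIV])
qed (simp_all add: norm_unitary norm_query_mat)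

text \<open>Weighting by the squared norm extends the acceptance probability to unnormalised states,
  so that it can serve as a leaf functional for phase 1.\<close>

definition accept :: "('n::finite bits \<Rightarrow> 'n bits) \<Rightarrow> (bool, 'w::finite, 'n) qalg \<Rightarrow>
    ('w, 'n) qstate \<Rightarrow> real" where
  "accept P c = leaf_sum P c (\<lambda>r \<phi>. of_bool r * (norm \<phi>)\<^sup>2)"

text \<open>The bias is used since its perturbation bound is that of the acceptance probability, so
  that passing from acceptance to bias gains the factor 2 needed for the constant 4.\<close>
definition bias :: "('n::finite bits \<Rightarrow> 'n bits) \<Rightarrow> (bool, 'w::finite, 'n) qalg \<Rightarrow>
    ('w, 'n) qstate \<Rightarrow> real" where
  "bias P c = leaf_sum P c (\<lambda>r \<phi>. (if r then 1 else -1) * (norm \<phi>)\<^sup>2)"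

lemma accept_eq_bias: "wf_qalg c \<Longrightarrow> accept P c \<psi> = ((norm \<psi>)\<^sup>2 + bias P c \<psi>) / 2"
  unfolding accept_def bias_def by (rule leaf_sum_split) auto

lemma accept_scaleR: "accept P c (k *\<^sub>R \<psi>) = k\<^sup>2 * accept P c \<psi>"
  unfolding accept_def by (rule leaf_sum_scaleR) (simp add: power_mult_distrib)

text \<open>At a leaf the bias is plus or minus the squared norm, and a difference of squared norms
  is the inner product of \<open>u - v\<close> and \<open>u + v\<close>.\<close>

lemma bias_perturb:
  fixes u v :: "('w::finite, 'n::finite) qstate"
  assumes "wf_qalg c"
  shows "\<bar>bias P c u - bias P c v\<bar> \<le> norm (u - v) * norm (u + v)"
  unfolding bias_def
proof (rule leaf_sum_perturb[OF assms])
  fix r and u v :: "('w, 'n) qstate"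
  have "(norm u)\<^sup>2 - (norm v)\<^sup>2 = inner (u - v) (u + v)"
    by (simp add: power2_norm_eq_inner inner_diff inner_add inner_commute)
  then have "\<bar>(norm u)\<^sup>2 - (norm v)\<^sup>2\<bar> \<le> norm (u - v) * norm (u + v)"
    using Cauchy_Schwarz_ineq2[of "u - v" "u + v"] by simp
  then show "\<bar>(if r then 1 else - 1) * (norm u)\<^sup>2 - (if r then 1 else - 1) * (norm v)\<^sup>2\<bar>
      \<le> norm (u - v) * norm (u + v)"
    by auto
qed

lemma prob_accept:
  assumes "wf_qalg c" "norm \<psi> = 1"
  shows "measure_pmf.expectation (run P c \<psi>) (\<lambda>(r, \<phi>). of_bool r) = accept P c \<psi>"
proof -
  \<comment> \<open>Final states are unit vectors, so the factor that makes the functional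
    homogeneous can be inserted.\<close>
  have "measure_pmf.expectation (run P c \<psi>) (\<lambda>(r, \<phi>). of_bool r)
      = measure_pmf.expectation (run P c \<psi>) (\<lambda>(r, \<phi>). of_bool r * (norm \<phi>)\<^sup>2 :: real)"
    by (intro integral_cong_AE) (auto simp: AE_measure_pmf_iff norm_run[OF assms])
  also have "\<dots> = accept P c \<psi>"
    unfolding accept_def
    using assms by (intro expectation_run[where F = "\<lambda>r \<phi>. of_bool r * (norm \<phi>)\<^sup>2"])
      (auto simp: power_mult_distrib)
  finally show ?thesis .
qed

section \<open>Unfolding the game\<close>

lemma map_fst_game: "map_pmf fst (game D) = pmf_of_set UNIV"
  by (simp add: game_def map_bind_pmf case_prod_unfold bind_return_pmf')

text \<open>Averaging from the inside out: acceptance in phase 2 is quadratically homogeneous in the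
  state and hence a valid leaf functional for phase 1. The denominator counts the choices of bit,
  \<open>s\<close>, \<open>t\<close> and \<open>P\<close>.\<close>

lemma prob_game:
  fixes D :: "('m, 'w::finite, 'n::finite) distinguisher"
  assumes "wf_distinguisher D"
  shows "measure_pmf.prob (game D) {(b, b'). b = \<beta> \<and> b'}
    = (\<Sum>s\<in>UNIV. \<Sum>t\<in>UNIV. \<Sum>P | bij P. leaf_sum P (phase1 D)
        (\<lambda>m. accept (if \<beta> then P \<circ> swap s t else P) (phase2 D m s t)) (init_state D))
      / (2 * real CARD('n bits) ^ 2 * real (card {P :: 'n bits \<Rightarrow> 'n bits. bij P}))"
proof -
  let ?S = "{P :: 'n bits \<Rightarrow> 'n bits. bij P}" and ?N = "real CARD('n bits)"
  let ?h = "indicator {(b, b'). b = \<beta> \<and> b'} :: bool \<times> bool \<Rightarrow> real"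
  define Q where "Q P b s t = (\<lambda>m. accept (if b then P \<circ> swap s t else P) (phase2 D m s t))"
    for P b s t
  define game2 where "game2 P m \<psi> = do {
     s0 \<leftarrow> pmf_of_set UNIV;
     s1 \<leftarrow> pmf_of_set UNIV;
     b \<leftarrow> pmf_of_set UNIV;
     (b', _) \<leftarrow> run (if b then P \<circ> swap s0 s1 else P) (phase2 D m s0 s1) \<psi>;
     return_pmf (b, b')
   }" for P m \<psi>
  have wf: "wf_qalg (phase2 D m s t)" for m s t
    using assms by (simp add: wf_distinguisher_def)
  have S: "?S \<noteq> {}"
    using bij_id by blast
  have last: "measure_pmf.expectation
        (do {(b', _) \<leftarrow> run P' (phase2 D m s t) \<psi>; return_pmf (b, b')}) ?h
      = of_bool (b = \<beta>) * accept P' (phase2 D m s t) \<psi>"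
    if "norm \<psi> = 1" for P' m s t \<psi> b
  proof -
    have "measure_pmf.expectation
          (do {(b', _) \<leftarrow> run P' (phase2 D m s t) \<psi>; return_pmf (b, b')}) ?h
        = measure_pmf.expectation (run P' (phase2 D m s t) \<psi>)
          (\<lambda>(b', _). of_bool (b = \<beta>) * of_bool b')"
      by (subst expectation_bind_finite)
        (auto simp: finite_set_run case_prod_unfold intro!: Bochner_Integration.integral_cong)
    then show ?thesis
      using prob_accept[OF wf that, of P' m s t] by (simp add: case_prod_unfold)
  qed
  have game2: "measure_pmf.expectation (game2 P m \<psi>) ?h
      = (\<Sum>s\<in>UNIV. \<Sum>t\<in>UNIV. Q P \<beta> s t m \<psi>) / (2 * ?N ^ 2)"
    if "norm \<psi> = 1" for P m \<psi>
  proof -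
    have "measure_pmf.expectation (game2 P m \<psi>) ?h
        = (\<Sum>s\<in>UNIV. (\<Sum>t\<in>UNIV. (\<Sum>b\<in>UNIV. of_bool (b = \<beta>) * Q P b s t m \<psi>) / 2) / ?N) / ?N"
      unfolding game2_def Q_def
      by (simp only: expectation_bind_uniform[OF UNIV_not_empty finite] last[OF that] card_UNIV_bool
          of_nat_numeral)
    also have "\<dots> = (\<Sum>s\<in>UNIV. \<Sum>t\<in>UNIV. Q P \<beta> s t m \<psi>) / (2 * ?N ^ 2)"
      by (cases \<beta>) (simp_all add: UNIV_bool power2_eq_square sum_divide_distrib mult.assoc)
    finally show ?thesis .
  qed
  have phase1: "measure_pmf.expectation
        (run P (phase1 D) (init_state D) \<bind> (\<lambda>(m, \<psi>). game2 P m \<psi>)) ?h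
      = (\<Sum>s\<in>UNIV. \<Sum>t\<in>UNIV. leaf_sum P (phase1 D) (Q P \<beta> s t) (init_state D)) / (2 * ?N ^ 2)" for P
  proof -
    have wf1: "wf_qalg (phase1 D)" "norm (init_state D) = 1"
      using assms by (auto simp: wf_distinguisher_def)
    have "measure_pmf.expectation (run P (phase1 D) (init_state D) \<bind> (\<lambda>(m, \<psi>). game2 P m \<psi>)) ?h
        = measure_pmf.expectation (run P (phase1 D) (init_state D))
           (\<lambda>(m, \<psi>). (\<Sum>s\<in>UNIV. \<Sum>t\<in>UNIV. Q P \<beta> s t m \<psi>) / (2 * ?N ^ 2))"
    proof -
      have "measure_pmf.expectation (game2 P (fst z) (snd z)) ?h
          = (\<Sum>s\<in>UNIV. \<Sum>t\<in>UNIV. Q P \<beta> s t (fst z) (snd z)) / (2 * ?N ^ 2)"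
        if "z \<in> set_pmf (run P (phase1 D) (init_state D))" for z
        using that by (intro game2 norm_run[OF wf1, of "fst z" _ P]) simp
      then show ?thesis
        unfolding case_prod_unfold
        unfolding expectation_bind_finite[OF finite_set_run finite]
        by (intro integral_cong_AE AE_pmfI) auto
    qed
    also have "\<dots> = leaf_sum P (phase1 D) 
        (\<lambda>m \<psi>. (\<Sum>s\<in>UNIV. \<Sum>t\<in>UNIV. Q P \<beta> s t m \<psi>) / (2 * ?N ^ 2)) (init_state D)"
      by (intro expectation_run[OF wf1]) (simp add: Q_def accept_scaleR sum_distrib_left)
    also have "\<dots>
        = (\<Sum>s\<in>UNIV. \<Sum>t\<in>UNIV. leaf_sum P (phase1 D) (Q P \<beta> s t) (init_state D)) / (2 * ?N ^ 2)"
      by (simp add: leaf_sum_divide leaf_sum_sum)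
    finally show ?thesis .
  qed
  have game: "game D
      = pmf_of_set ?S \<bind> (\<lambda>P. run P (phase1 D) (init_state D) \<bind> (\<lambda>(m, \<psi>). game2 P m \<psi>))"
    by (simp add: game_def game2_def)
  have "measure_pmf.prob (game D) {(b, b'). b = \<beta> \<and> b'} = measure_pmf.expectation (game D) ?h"
    by simp
  also have "\<dots>
      = (\<Sum>P\<in>?S. (\<Sum>s\<in>UNIV. \<Sum>t\<in>UNIV. leaf_sum P (phase1 D) (Q P \<beta> s t) (init_state D))
          / (2 * ?N ^ 2)) / real (card ?S)"
    unfolding game by (simp only: expectation_bind_uniform[OF S finite] phase1)
  also have "\<dots> = (\<Sum>P\<in>?S. \<Sum>s\<in>UNIV. \<Sum>t\<in>UNIV. leaf_sum P (phase1 D) (Q P \<beta> s t) (init_state D))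
      / (2 * ?N ^ 2 * real (card ?S))"
    by (simp flip: sum_divide_distrib)
  also have "(\<Sum>P\<in>?S. \<Sum>s\<in>UNIV. \<Sum>t\<in>UNIV. leaf_sum P (phase1 D) (Q P \<beta> s t) (init_state D))
      = (\<Sum>s\<in>UNIV. \<Sum>t\<in>UNIV. \<Sum>P\<in>?S. leaf_sum P (phase1 D) (Q P \<beta> s t) (init_state D))"
    by (subst sum.swap, rule sum.cong[OF refl], subst sum.swap, rule refl)
  finally show ?thesis
    by (simp only: Q_def)
qed

theorem lemma5:
  fixes D :: "('m, 'w::finite, 'n::finite) distinguisher" and q :: nat
  assumes "wf_distinguisher D"
    and "num_queries (phase1 D) \<le> q"
  shows "\<bar>\<P>((b, b') in game D. b' \<bar> b) - \<P>((b, b') in game D. b' \<bar> \<not> b)\<bar>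
    \<le> 4 * sqrt (real q / 2 ^ CARD('n))"
proof -
  let ?N = "real CARD('n bits)" and ?A = "phase1 D" and ?\<psi> = "init_state D"
  define n where "n = real (card {P :: 'n bits \<Rightarrow> 'n bits. bij P})"
  define G where "G P s t m = bias P (phase2 D m s t)" for P s t m
  \<comment> \<open>Phase 2 sees \<open>P\<close> in both terms; only phase 1 is run with
    \<open>P\<close> or with the swapped permutation.\<close>
  define T where "T = (\<Sum>s\<in>UNIV. \<Sum>t\<in>UNIV. \<Sum>P | bij P.
      leaf_sum P ?A (G P s t) ?\<psi> - leaf_sum (P \<circ> swap s t) ?A (G P s t) ?\<psi>)"
  have wf: "norm ?\<psi> = 1" "wf_qalg ?A" "wf_qalg (phase2 D m s t)" for m s t
    using assms by (auto simp: wf_distinguisher_def)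
  have N: "?N > 0"
    by simp
  have n: "n > 0"
    using bij_id by (auto simp: n_def card_gt_0_iff)
  \<comment> \<open>The constant 1 cancels between the two games, which leaves half the difference
    of the biases.\<close>
  have split: "leaf_sum P' ?A (\<lambda>m. accept P (phase2 D m s t)) ?\<psi>
      = (1 + leaf_sum P' ?A (G P s t) ?\<psi>) / 2" for P P' s t
    using leaf_sum_split[OF wf(2), of "\<lambda>m. accept P (phase2 D m s t)" "G P s t" P' ?\<psi>] wf(1)
    by (simp add: accept_eq_bias[OF wf(3)] G_def)
  have marginal: "measure_pmf.prob (game D) {(b, b'). b = \<beta>} = 1 / 2" for \<beta>
  proof -
    have "measure_pmf.prob (map_pmf fst (game D)) {\<beta>} = 1 / 2"
      unfolding map_fst_game by (simp add: measure_pmf_of_set)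
    moreover have "fst -` {\<beta>} = {(b, b' :: bool). b = \<beta>}"
      by (rule set_eqI) (simp add: case_prod_unfold)
    ultimately show ?thesis
      by (simp only: measure_map_pmf)
  qed
  \<comment> \<open>Either value of the bit has probability 1/2, hence the factor 2.\<close>
  have cond: "\<P>((b, b') in game D. b' \<bar> b) = 2 * measure_pmf.prob (game D) {(b, b'). b = True \<and> b'}"
    "\<P>((b, b') in game D. b' \<bar> \<not> b) = 2 * measure_pmf.prob (game D) {(b, b'). b = False \<and> b'}"
  proof -
    have "\<P>((b, b') in game D. b' \<bar> b) = measure_pmf.prob (game D) {(b, b'). b = True \<and> b'}
        / measure_pmf.prob (game D) {(b, b'). b = True}"
      "\<P>((b, b') in game D. b' \<bar> \<not> b) = measure_pmf.prob (game D) {(b, b'). b = False \<and> b'}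
        / measure_pmf.prob (game D) {(b, b'). b = False}"
      unfolding cond_prob_def
      by (intro arg_cong2[where f = "(/)"] arg_cong[where f = "measure_pmf.prob (game D)"]; auto)+
    then show "\<P>((b, b') in game D. b' \<bar> b)
        = 2 * measure_pmf.prob (game D) {(b, b'). b = True \<and> b'}"
      "\<P>((b, b') in game D. b' \<bar> \<not> b)
        = 2 * measure_pmf.prob (game D) {(b, b'). b = False \<and> b'}"
      unfolding marginal by auto
  qed
  have real: "2 * measure_pmf.prob (game D) {(b, b'). b = False \<and> b'}
      = (\<Sum>s\<in>UNIV. \<Sum>t\<in>UNIV. \<Sum>P | bij P. (1 + leaf_sum P ?A (G P s t) ?\<psi>) / 2) / (?N ^ 2 * n)"
    unfolding prob_game[OF assms(1)] n_def[symmetric] by (simp add: split)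
  \<comment> \<open>Since \<open>P \<circ> swap s t\<close> is again uniform and \<open>swap\<close>
    is an involution, reprogramming in phase 2 is traded for reprogramming in phase 1.\<close>
  have swapped: "(\<Sum>P | bij P. (1 + leaf_sum P ?A (G (P \<circ> swap s t) s t) ?\<psi>) / 2)
      = (\<Sum>P | bij P. (1 + leaf_sum (P \<circ> swap s t) ?A (G P s t) ?\<psi>) / 2)" for s t
    by (subst sum_bij_transpose[symmetric, of _ s t]) (simp add: comp_assoc)
  have reprogrammed: "2 * measure_pmf.prob (game D) {(b, b'). b = True \<and> b'}
      = (\<Sum>s\<in>UNIV. \<Sum>t\<in>UNIV. \<Sum>P | bij P.
          (1 + leaf_sum (P \<circ> swap s t) ?A (G P s t) ?\<psi>) / 2) / (?N ^ 2 * n)"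
    unfolding prob_game[OF assms(1)] n_def[symmetric] swapped[symmetric] by (simp add: split)
  \<comment> \<open>Phase 1 starts from a constant state, which has degree 0, and its unit norm
    makes the squared norms sum to \<open>n\<close>.\<close>
  have "\<bar>T\<bar> \<le> sqrt (32 * real q * ?N ^ 3) * n"
    using leaf_sum_swap_le[where G = G and f = "\<lambda>_. ?\<psi>" and k = 0 and c = ?A and q = q]
      bias_perturb[OF wf(3)] wf assms(2)
    by (simp add: T_def n_def G_def low_degree_const)
  have "\<P>((b, b') in game D. b' \<bar> \<not> b) - \<P>((b, b') in game D. b' \<bar> b) = T / (2 * ?N ^ 2 * n)"
    unfolding cond real reprogrammed diff_divide_distrib[symmetric] sum_subtractf[symmetric]
    by (simp add: T_def flip: sum_divide_distrib diff_divide_distrib)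
  then have "\<bar>\<P>((b, b') in game D. b' \<bar> b) - \<P>((b, b') in game D. b' \<bar> \<not> b)\<bar>
      = \<bar>T\<bar> / (2 * ?N ^ 2 * n)"
    using n by (subst abs_minus_commute) (simp add: abs_mult)
  also have "\<dots> \<le> sqrt (32 * real q * ?N ^ 3) * n / (2 * ?N ^ 2 * n)"
    using \<open>\<bar>T\<bar> \<le> _\<close> n by (intro divide_right_mono) auto
  also have "\<dots> = sqrt (8 * (real q / ?N))"
  proof -
    \<comment> \<open>The denominator \<open>2 * ?N ^ 2\<close> is absorbed into the root: 32 / 4 =
      8, and one power of \<open>?N\<close> remains below.\<close>
    have "32 * real q * ?N ^ 3 = (2 * ?N ^ 2)\<^sup>2 * (8 * (real q / ?N))"
      using N by (simp add: field_simps power_numeral_reduce)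
    then have "sqrt (32 * real q * ?N ^ 3) = 2 * ?N ^ 2 * sqrt (8 * (real q / ?N))"
      by (simp only: real_sqrt_mult real_sqrt_abs) simp
    then show ?thesis
      using n N by simp
  qed
  \<comment> \<open>The constant 8 is rounded up to the square 16.\<close>
  also have "\<dots> \<le> sqrt (4\<^sup>2 * (real q / ?N))"
    by (intro real_sqrt_le_mono mult_right_mono) auto
  also have "\<dots> = 4 * sqrt (real q / 2 ^ CARD('n))"
    unfolding real_sqrt_mult by simp
  finally show ?thesis .
qed

end
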